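(* Consider the combined heat and power network under Mode 2 (described in the context), with constant loads $p^L,h^L$, where the heating network is connected to the power network through the heat pump bus $j$, $H_e=\{j\}$. Then at an equilibrium of the system, the power contributions of the electric generators $p^G$ and of the conventional heat sources $h^G$ (together with $p^U$ and $p^P$, $h^P$) are the solution of the combined heat and power optimization problem $$\min_{p^G,h^G,p^U}\ \tfrac12(p^G)^TQ_ep^G+\tfrac12(h^G)^T\alpha_jQ_hh^G+\tfrac12(p^U)^TQ_up^U$$ $$\text{s.t.}\quad \mathbf 1^Tp^G=\mathbf 1^Tp^L+\mathbf 1^Tp^P+\mathbf 1^Tp^U,\qquad \mathbf 1^Th^G=\mathbf 1^Th^L-\mathbf 1^Th^P,\qquad h^P_{k_j}=C_{o,j}p^P_j,\ j\in H_e,$$ where $\alpha_j=\frac{m_j}{C_{o,j}}$, $j\in H_e$, $Q_e=\mathrm{diag}(\{Q_{e,ii}\})_{i\in N_e^G}$, $Q_h=\mathrm{diag}(\{Q_{h,ii}\})_{i\in E_h^G}$, $Q_u=\mathrm{diag}(\{1/D_i\})$, and where $p^P$ and $h^P$ are also free variables of the problem (subject to the constraints).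
   Context: **Electric network.** $(N_e,E_e)$ is a finite connected directed graph; $N_e$ is the set of buses, $E_e\subseteq N_e\times N_e$ the set of transmission lines. $N_e^G\subseteq N_e$ is the set of generator buses and $H_e=\{j\}\subseteq N_e$ consists of the heat pump (converter) bus, $j\notin N_e^G$. For each bus $i\in N_e\setminus H_e$, $$M_i\dot\omega_i=-p^L_i+p^G_i-p^U_i+\sum_{l:\,l\to i}p_{li}-\sum_{k:\,i\to k}p_{ik},$$ and for each line $(i,l)\in E_e$, $\dot\eta_{il}=\omega_i-\omega_l$, $p_{il}=B_{il}\sin(\eta_{il})$ with $B_{il}>0$. Here $\omega_i$ is the frequency deviation at bus $i$, $\eta_{il}$ the angle difference between buses $i$ and $l$, $p^U_i=D_i\omega_i$ with $D_i>0$, $p^L_i$ is a constant load, $p^G_i$ is the generation. If $i\in N_e^G$ then $M_i>0$; if $i$ is a load bus, $M_i=0$ and $p^G_i=0$. **Heating network.** $(N_h,E_h)$ is a finite directed graph with nodes $N_h$ and edges $E_h$; $H_h=\{k_j\}\subseteq E_h$ is the edge carrying the heat pump, $E_h^G\subseteq E_h$ are the edges carrying conventional heat sources, $E_h^L\subseteq E_h$ those carrying heat loads. With $T=\mathrm{col}(T^E,T^N)$ the vector of edge and node temperature deviations, $$V\dot T=-A_hT+\begin{bmatrix}h^G+h^P-h^L\\ \mathbf 0\end{bmatrix},\qquad A_h=\begin{bmatrix}\mathrm{diag}(q^E)&-\mathrm{diag}(q^E)B_{sh}^T\\-B_{th}\mathrm{diag}(q^E)&\mathrm{diag}(B_{th}q^E)\end{bmatrix},$$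 where $V=\mathrm{diag}(\{V^E_i\},\{V^N_k\})$ has positive volumes on the diagonal, $q^E$ is a given constant vector of edge mass flows, $B_h$ is the incidence matrix (entry $(i,l)$ equal to $1$ if the flow through edge $l$ enters node $i$, $-1$ if it originates from node $i$, $0$ otherwise), $B_{th}=\frac12(|B_h|+B_h)$, $B_{sh}=\frac12(|B_h|-B_h)$ (entrywise absolute value). $h^P,h^G,h^L\in\mathbb R^{E_h}$ are supported on $H_h$, $E_h^G$, $E_h^L$ respectively, and $h^L$ is constant. The matrix $A_h$ satisfies: $A_h+A_h^T$ is positive semidefinite with a simple eigenvalue at $0$, $A_h\mathbf 1=0$, $\mathbf 1^TA_h=0$. The average temperature is $\bar T=\frac{\mathbf 1^TVT}{\mathcal V}$ with $\mathcal V=\mathbf 1^TV\mathbf 1$. **Generation control.** With positive constants $\tau_{e,i},Q_{e,ii},\tau_{h,i},Q_{h,ii}$ and $\tilde Q_{e,ii}=1/Q_{e,ii}$, $\tilde Q_{h,ii}=1/Q_{h,ii}$: $$\tau_{e,i}\dot p^G_i=-p^G_i-\tilde Q_{e,ii}\omega_i,\ i\in N_e^G;\qquad \tau_{h,i}\dot h^G_i=-h^G_i-\tilde Q_{h,ii}\bar T,\ i\in E_h^G.$$ **Heat pump (Mode 2).** $h^P_{k_j}=C_{o,j}p^P_j$ with constant $C_{o,j}>0$. The pump bus $j$ is a separate bus with zero inertia, no load, no generation and no damping term, satisfying $$0=-p^P_j+\sum_{i:\,i\to j}p_{ij}-\sum_{k:\,j\to k}p_{jk},\qquad \omega_j=m_j\bar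 T,$$ with constant $m_j>0$. **Conventions.** An equilibrium is a point $(\eta,\omega,p^G,T,h^G)$ at which all these variables are constant in time; at an equilibrium all bus frequencies are equal. In the optimization problem, $p^G$ is indexed by $N_e^G$, $p^U$ and $p^L$ by $N_e\setminus H_e$, $p^P$ by $H_e$, $h^G$ by $E_h^G$ (other entries are zero), and $\mathbf 1$ is the all-ones vector of appropriate dimension. *)

theory Defs
  imports "HOL-Analysis.Analysis" "HOL-Computational_Algebra.Polynomial"
begin

section \<open>Matrices\<close>

definition diag :: "'a::zero ^ 'n \<Rightarrow> 'a ^ 'n ^ 'n" where
  "diag v = (\<chi> a b. if a = b then v $ a else 0)"

definition block_mat ::
  "'a ^ 'm ^ 'r \<Rightarrow> 'a ^ 'n ^ 'r \<Rightarrow> 'a ^ 'm ^ 's \<Rightarrow> 'a ^ 'n ^ 's \<Rightarrow> 'a ^ ('m + 'n) ^ ('r + 's)" where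
  "block_mat P Q R S = (\<chi> a b.
     case a of
       Inl i \<Rightarrow> (case b of Inl l \<Rightarrow> P $ i $ l | Inr k \<Rightarrow> Q $ i $ k)
     | Inr i \<Rightarrow> (case b of Inl l \<Rightarrow> R $ i $ l | Inr k \<Rightarrow> S $ i $ k))"

definition block_vec :: "'a ^ 'm \<Rightarrow> 'a ^ 'n \<Rightarrow> 'a ^ ('m + 'n)" where
  "block_vec u v = (\<chi> a. case a of Inl i \<Rightarrow> u $ i | Inr k \<Rightarrow> v $ k)"

definition psd :: "real ^ 'n ^ 'n \<Rightarrow> bool" where
  "psd A \<longleftrightarrow> transpose A = A \<and> (\<forall>x. 0 \<le> x \<bullet> (A *v x))"

definition charpoly :: "real ^ 'n ^ 'n \<Rightarrow> real poly" where
  "charpoly A = det (\<chi> a b. (if a = b then [:0, 1:] else 0) - [:A $ a $ b:])"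

definition simple_eigenvalue :: "real ^ 'n ^ 'n \<Rightarrow> real \<Rightarrow> bool" where
  "simple_eigenvalue A \<mu> \<longleftrightarrow> order \<mu> (charpoly A) = 1"

definition supported_on :: "'a::zero ^ 'n \<Rightarrow> 'n set \<Rightarrow> bool" where
  "supported_on x S \<longleftrightarrow> (\<forall>i. i \<notin> S \<longrightarrow> x $ i = 0)"


section \<open>Network data\<close>

text \<open>The buses are the elements of the finite type \<open>'n\<close>, the heating edges those of \<open>'e\<close> and
  the heating nodes those of \<open>'k\<close>. Quantities that live on a subset of buses or edges are vectors
  over the whole type which vanish off that subset; entries of constant parameters off their
  index set are never used. The heating edge \<open>l\<close> is directed from \<open>heat_tail l\<close> to \<open>heat_head l\<close>.\<close>

record ('n::finite, 'e::finite, 'k::finite) chp =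
  elines :: "('n \<times> 'n) set"           \<comment> \<open>\<open>E\<^sub>e\<close>\<close>
  generators :: "'n set"             \<comment> \<open>\<open>N\<^sub>e\<^sup>G\<close>\<close>
  pump_bus :: 'n                     \<comment> \<open>\<open>j\<close>, so that \<open>H\<^sub>e = {j}\<close>\<close>
  inertia :: "real ^ 'n"             \<comment> \<open>\<open>M\<close>\<close>
  damping :: "real ^ 'n"             \<comment> \<open>\<open>D\<close>\<close>
  line_coeff :: "real ^ 'n ^ 'n"     \<comment> \<open>\<open>B\<^sub>i\<^sub>l\<close>\<close>
  eload :: "real ^ 'n"               \<comment> \<open>\<open>p\<^sup>L\<close>\<close>
  heat_tail :: "'e \<Rightarrow> 'k"
  heat_head :: "'e \<Rightarrow> 'k"
  heat_sources :: "'e set"           \<comment> \<open>\<open>E\<^sub>h\<^sup>G\<close>\<close>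
  heat_loads :: "'e set"             \<comment> \<open>\<open>E\<^sub>h\<^sup>L\<close>\<close>
  pump_edge :: 'e                    \<comment> \<open>\<open>k\<^sub>j\<close>, so that \<open>H\<^sub>h = {k\<^sub>j}\<close>\<close>
  mass_flow :: "real ^ 'e"           \<comment> \<open>\<open>q\<^sup>E\<close>\<close>
  edge_volume :: "real ^ 'e"         \<comment> \<open>\<open>V\<^sup>E\<close>\<close>
  node_volume :: "real ^ 'k"         \<comment> \<open>\<open>V\<^sup>N\<close>\<close>
  hload :: "real ^ 'e"               \<comment> \<open>\<open>h\<^sup>L\<close>\<close>
  tau_e :: "real ^ 'n"
  tau_h :: "real ^ 'e"
  cost_e :: "real ^ 'n"              \<comment> \<open>diagonal of \<open>Q\<^sub>e\<close>\<close>
  cost_h :: "real ^ 'e"              \<comment> \<open>diagonal of \<open>Q\<^sub>h\<close>\<close>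
  cop :: real                        \<comment> \<open>\<open>C\<^sub>o\<^sub>,\<^sub>j\<close>\<close>
  pump_gain :: real                  \<comment> \<open>\<open>m\<^sub>j\<close>\<close>

definition heat_incidence :: "('n::finite, 'e::finite, 'k::finite) chp \<Rightarrow> real ^ 'e ^ 'k" where
  "heat_incidence N = (\<chi> i l. if heat_head N l = i then 1 else if heat_tail N l = i then - 1 else 0)"

definition B_th :: "('n::finite, 'e::finite, 'k::finite) chp \<Rightarrow> real ^ 'e ^ 'k" where
  "B_th N = (\<chi> i l. (\<bar>heat_incidence N $ i $ l\<bar> + heat_incidence N $ i $ l) / 2)"

definition B_sh :: "('n::finite, 'e::finite, 'k::finite) chp \<Rightarrow> real ^ 'e ^ 'k" where
  "B_sh N = (\<chi> i l. (\<bar>heat_incidence N $ i $ l\<bar> - heat_incidence N $ i $ l) / 2)"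

definition A_h :: "('n::finite, 'e::finite, 'k::finite) chp \<Rightarrow> real ^ ('e + 'k) ^ ('e + 'k)" where
  "A_h N = block_mat
     (diag (mass_flow N)) (- (diag (mass_flow N) ** transpose (B_sh N)))
     (- (B_th N ** diag (mass_flow N))) (diag (B_th N *v mass_flow N))"

definition vol :: "('n::finite, 'e::finite, 'k::finite) chp \<Rightarrow> real ^ ('e + 'k) ^ ('e + 'k)" where
  "vol N = diag (block_vec (edge_volume N) (node_volume N))"

definition avg_temp :: "('n::finite, 'e::finite, 'k::finite) chp \<Rightarrow> real ^ ('e + 'k) \<Rightarrow> real" where
  "avg_temp N T = (1 \<bullet> (vol N *v T)) / (1 \<bullet> (vol N *v 1))"

definition chp_network :: "('n::finite, 'e::finite, 'k::finite) chp \<Rightarrow> bool" where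
  "chp_network N \<longleftrightarrow>
     (elines N \<union> (elines N)\<inverse>)\<^sup>* = UNIV \<and>
     pump_bus N \<notin> generators N \<and>
     (\<forall>i\<in>generators N. 0 < inertia N $ i) \<and>
     (\<forall>i. i \<notin> generators N \<and> i \<noteq> pump_bus N \<longrightarrow> inertia N $ i = 0) \<and>
     (\<forall>i. i \<noteq> pump_bus N \<longrightarrow> 0 < damping N $ i) \<and>
     (\<forall>(i, l)\<in>elines N. 0 < line_coeff N $ i $ l) \<and>
     supported_on (eload N) (- {pump_bus N}) \<and>
     (\<forall>l. 0 < edge_volume N $ l) \<and>
     (\<forall>k. 0 < node_volume N $ k) \<and>
     supported_on (hload N) (heat_loads N) \<and>
     psd (A_h N + transpose (A_h N)) \<and>
     simple_eigenvalue (A_h N + transpose (A_h N)) 0 \<and>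
     A_h N *v 1 = 0 \<and>
     1 v* A_h N = 0 \<and>
     (\<forall>i\<in>generators N. 0 < tau_e N $ i \<and> 0 < cost_e N $ i) \<and>
     (\<forall>l\<in>heat_sources N. 0 < tau_h N $ l \<and> 0 < cost_h N $ l) \<and>
     0 < cop N \<and>
     0 < pump_gain N"


section \<open>Dynamics in Mode 2\<close>

definition line_power :: "('n::finite, 'e::finite, 'k::finite) chp \<Rightarrow> real ^ 'n ^ 'n \<Rightarrow> 'n \<Rightarrow> 'n \<Rightarrow> real" where
  "line_power N \<eta> i l = line_coeff N $ i $ l * sin (\<eta> $ i $ l)"

definition net_inflow :: "('n::finite, 'e::finite, 'k::finite) chp \<Rightarrow> real ^ 'n ^ 'n \<Rightarrow> 'n \<Rightarrow> real" where
  "net_inflow N \<eta> i =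
     (\<Sum>l | (l, i) \<in> elines N. line_power N \<eta> l i) - (\<Sum>k | (i, k) \<in> elines N. line_power N \<eta> i k)"

text \<open>The arguments are trajectories. A differential equation \<open>c y' = r\<close> with constant \<open>c\<close> is
  written as \<open>(c y)' = r\<close>: for \<open>c \<noteq> 0\<close> this is the same, and for a load bus, where
  \<open>M\<^sub>i = 0\<close>, it is the algebraic equation \<open>0 = r\<close> with no differentiability demanded of
  \<open>\<omega>\<^sub>i\<close>. Only the entries \<open>\<eta>\<^sub>i\<^sub>l\<close> with \<open>(i, l) \<in> E\<^sub>e\<close> are meaningful.\<close>

definition chp_solution ::
  "('n::finite, 'e::finite, 'k::finite) chp \<Rightarrow> (real \<Rightarrow> real ^ 'n ^ 'n) \<Rightarrow> (real \<Rightarrow> real ^ 'n) \<Rightarrow>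
   (real \<Rightarrow> real ^ 'n) \<Rightarrow> (real \<Rightarrow> real ^ ('e + 'k)) \<Rightarrow> (real \<Rightarrow> real ^ 'e) \<Rightarrow>
   (real \<Rightarrow> real ^ 'n) \<Rightarrow> (real \<Rightarrow> real ^ 'n) \<Rightarrow> (real \<Rightarrow> real ^ 'e) \<Rightarrow> bool" where
  "chp_solution N \<eta> \<omega> pG T hG pU pP hP \<longleftrightarrow> (\<forall>t\<ge>0.
     supported_on (pG t) (generators N) \<and>
     supported_on (hG t) (heat_sources N) \<and>
     supported_on (pU t) (- {pump_bus N}) \<and>
     supported_on (pP t) {pump_bus N} \<and>
     supported_on (hP t) {pump_edge N} \<and>
     (\<forall>(i, l)\<in>elines N.
        ((\<lambda>s. \<eta> s $ i $ l) has_real_derivative \<omega> t $ i - \<omega> t $ l) (at t within {0..})) \<and>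
     (\<forall>i. i \<noteq> pump_bus N \<longrightarrow>
        pU t $ i = damping N $ i * \<omega> t $ i \<and>
        ((\<lambda>s. inertia N $ i * \<omega> s $ i) has_real_derivative
           - eload N $ i + pG t $ i - pU t $ i + net_inflow N (\<eta> t) i) (at t within {0..})) \<and>
     0 = - (pP t $ pump_bus N) + net_inflow N (\<eta> t) (pump_bus N) \<and>
     \<omega> t $ pump_bus N = pump_gain N * avg_temp N (T t) \<and>
     hP t $ pump_edge N = cop N * pP t $ pump_bus N \<and>
     ((\<lambda>s. vol N *v T s) has_vector_derivative
        - (A_h N *v T t) + block_vec (hG t + hP t - hload N) 0) (at t within {0..}) \<and>
     (\<forall>i\<in>generators N.
        ((\<lambda>s. tau_e N $ i * pG s $ i) has_real_derivative
           - (pG t $ i) - 1 / cost_e N $ i * \<omega> t $ i) (at t within {0..})) \<and>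
     (\<forall>l\<in>heat_sources N.
        ((\<lambda>s. tau_h N $ l * hG s $ l) has_real_derivative
           - (hG t $ l) - 1 / cost_h N $ l * avg_temp N (T t)) (at t within {0..})))"

text \<open>The last three arguments are the values of the algebraic variables, which the state
  \<open>(\<eta>, \<omega>, p\<^sup>G, T, h\<^sup>G)\<close> determines.\<close>

definition chp_equilibrium ::
  "('n::finite, 'e::finite, 'k::finite) chp \<Rightarrow> real ^ 'n ^ 'n \<Rightarrow> real ^ 'n \<Rightarrow>
   real ^ 'n \<Rightarrow> real ^ ('e + 'k) \<Rightarrow> real ^ 'e \<Rightarrow>
   real ^ 'n \<Rightarrow> real ^ 'n \<Rightarrow> real ^ 'e \<Rightarrow> bool" where
  "chp_equilibrium N \<eta> \<omega> pG T hG pU pP hP \<longleftrightarrow>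
     chp_solution N (\<lambda>_. \<eta>) (\<lambda>_. \<omega>) (\<lambda>_. pG) (\<lambda>_. T) (\<lambda>_. hG) (\<lambda>_. pU) (\<lambda>_. pP) (\<lambda>_. hP)"


section \<open>The optimization problem\<close>

text \<open>The decision variables are \<open>(p\<^sup>G, h\<^sup>G, p\<^sup>U, p\<^sup>P, h\<^sup>P)\<close>.\<close>

definition chp_feasible ::
  "('n::finite, 'e::finite, 'k::finite) chp \<Rightarrow>
   (real ^ 'n) \<times> (real ^ 'e) \<times> (real ^ 'n) \<times> (real ^ 'n) \<times> (real ^ 'e) \<Rightarrow> bool" where
  "chp_feasible N = (\<lambda>(pG, hG, pU, pP, hP).
     supported_on pG (generators N) \<and>
     supported_on hG (heat_sources N) \<and>
     supported_on pU (- {pump_bus N}) \<and>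
     supported_on pP {pump_bus N} \<and>
     supported_on hP {pump_edge N} \<and>
     1 \<bullet> pG = 1 \<bullet> eload N + 1 \<bullet> pP + 1 \<bullet> pU \<and>
     1 \<bullet> hG = 1 \<bullet> hload N - 1 \<bullet> hP \<and>
     hP $ pump_edge N = cop N * pP $ pump_bus N)"

definition chp_cost ::
  "('n::finite, 'e::finite, 'k::finite) chp \<Rightarrow>
   (real ^ 'n) \<times> (real ^ 'e) \<times> (real ^ 'n) \<times> (real ^ 'n) \<times> (real ^ 'e) \<Rightarrow> real" where
  "chp_cost N = (\<lambda>(pG, hG, pU, pP, hP).
     (let \<alpha> = pump_gain N / cop N; Q_u = diag (\<chi> i. 1 / damping N $ i) in
        1 / 2 * (pG \<bullet> (diag (cost_e N) *v pG)) +
        1 / 2 * (hG \<bullet> ((\<alpha> *\<^sub>R diag (cost_h N)) *v hG)) +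
        1 / 2 * (pU \<bullet> (Q_u *v pU))))"

end

theory Submission
  imports Defs
begin

text \<open>At an equilibrium all frequencies equal one value \<open>w\<close>, and the constraints of the problem are the
  sums of the balance equations over the buses and over the heating network. The control laws make
  the cost gradient constant on each block of variables: \<open>- w\<close> for \<open>p\<^sup>G\<close>, \<open>w\<close> for \<open>p\<^sup>U\<close> and, by
  \<open>w = m\<^sub>j T\<close> with \<open>T\<close> the average temperature, \<open>- \<alpha>\<^sub>j T = - w / C\<^sub>o\<^sub>,\<^sub>j\<close> for \<open>h\<^sup>G\<close>. The constraints make
  this gradient vanish on every feasible direction, so the cost of a feasible point exceeds that of
  the equilibrium by a quadratic form which is positive definite on the supports.\<close>

section \<open>Diagonal quadratic forms\<close>

lemma inner_diag: "x \<bullet> (diag c *v y) = (\<Sum>i\<in>UNIV. c $ i * x $ i * y $ i)"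
  for x y c :: "real ^ 'n::finite"
proof -
  have "(diag c *v y) $ i = c $ i * y $ i" for i
    by (simp add: diag_def matrix_vector_mult_def if_distrib[of "\<lambda>a. a * _"] cong: if_cong)
  then show ?thesis
    by (simp add: inner_vec_def mult_ac)
qed

lemma inner_one_left: "1 \<bullet> x = (\<Sum>i\<in>UNIV. x $ i)"
  for x :: "real ^ 'n::finite"
  by (simp add: inner_vec_def)

lemma inner_one_supported_singleton:
  fixes x :: "real ^ 'n::finite"
  assumes "supported_on x {j}"
  shows "1 \<bullet> x = x $ j"
proof -
  have "(\<Sum>i\<in>UNIV. x $ i) = (\<Sum>i\<in>{j}. x $ i)"
    using assms by (intro sum.mono_neutral_right) (auto simp: supported_on_def)
  then show ?thesis
    by (simp add: inner_one_left)
qed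

lemma supported_on_diff:
  "supported_on x S \<Longrightarrow> supported_on y S \<Longrightarrow> supported_on (x - y) S"
  for x y :: "'a::group_add ^ 'n"
  by (simp add: supported_on_def)

lemma supported_on_singleton_eqI:
  "supported_on x {j} \<Longrightarrow> supported_on y {j} \<Longrightarrow> x $ j = y $ j \<Longrightarrow> x = y"
  unfolding supported_on_def vec_eq_iff by (metis singletonD)

text \<open>An exact second-order expansion at \<open>x\<close>. On \<open>S\<close> all gradient
  entries equal \<open>2 * g\<close>, so the linear term sees \<open>y - x\<close> only through the
  sum of its entries; off \<open>S\<close> both vectors vanish, whatever \<open>c\<close> is
  there.\<close>

lemma diag_form_expand:
  fixes x y c :: "real ^ 'n::finite"
  assumes "supported_on x S" "supported_on y S" "\<And>i. i \<in> S \<Longrightarrow> c $ i * x $ i = g"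
  shows "y \<bullet> (diag c *v y) =
    x \<bullet> (diag c *v x) + 2 * g * (1 \<bullet> y - 1 \<bullet> x) + (y - x) \<bullet> (diag c *v (y - x))"
proof -
  have "c $ i * y $ i * y $ i = c $ i * x $ i * x $ i + 2 * g * (y $ i - x $ i)
      + c $ i * (y $ i - x $ i) * (y $ i - x $ i)" for i
  proof (cases "i \<in> S")
    case True
    then show ?thesis
      unfolding assms(3)[OF True, symmetric] by (simp add: algebra_simps)
  next
    case False
    then show ?thesis
      using assms(1,2) by (simp add: supported_on_def)
  qed
  then show ?thesis
    by (simp add: inner_diag inner_one_left sum.distrib sum_distrib_left sum_subtractf
        right_diff_distrib)
qed

lemma diag_form_nonneg:
  fixes x c :: "real ^ 'n::finite"
  assumes "supported_on x S" "\<And>i. i \<in> S \<Longrightarrow> 0 < c $ i"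
  shows "0 \<le> x \<bullet> (diag c *v x)"
proof -
  have "0 \<le> c $ i * x $ i * x $ i" for i
    using assms by (cases "i \<in> S") (auto simp: supported_on_def mult.assoc less_imp_le)
  then show ?thesis
    by (simp add: inner_diag sum_nonneg)
qed

lemma diag_form_eq_0D:
  fixes x c :: "real ^ 'n::finite"
  assumes "supported_on x S" "\<And>i. i \<in> S \<Longrightarrow> 0 < c $ i" "x \<bullet> (diag c *v x) = 0"
  shows "x = 0"
proof -
  have nonneg: "0 \<le> c $ i * x $ i * x $ i" for i
    using assms by (cases "i \<in> S") (auto simp: supported_on_def mult.assoc less_imp_le)
  have "c $ i * x $ i * x $ i = 0" for i
    using assms(3) nonneg by (simp add: inner_diag sum_nonneg_eq_0_iff)
  then have "x $ i = 0" for i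
    using assms(1,2) by (metis less_irrefl mult_eq_0_iff supported_on_def)
  then show ?thesis
    by (simp add: vec_eq_iff)
qed


section \<open>Equilibria\<close>

lemma has_vector_derivative_const_halfline:
  fixes c d :: "'a::real_normed_vector"
  assumes "((\<lambda>_. c) has_vector_derivative d) (at 0 within {0::real..})"
  shows "d = 0"
proof -
  \<comment> \<open>Uniqueness of a derivative within a set needs a nontrivial filter; at the end
    point 0 it is the right-sided one.\<close>
  have "at 0 within {0::real..} \<noteq> bot"
    by (simp add: at_within_Ici_at_right)
  then show ?thesis
    using assms has_vector_derivative_const vector_derivative_unique_within by blast
qed

lemma has_real_derivative_const_halfline:
  "((\<lambda>_. c) has_real_derivative d) (at 0 within {0::real..}) \<Longrightarrow> d = 0"
  by (simp add: has_real_derivative_iff_has_vector_derivative has_vector_derivative_const_halfline)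

text \<open>Lines are lossless: the power of a line is added at its head and subtracted at its tail.
  Exchanging the two summations matches these contributions.\<close>

lemma sum_net_inflow: "(\<Sum>i\<in>UNIV. net_inflow N \<eta> i) = 0"
proof -
  have "(\<Sum>i\<in>UNIV. \<Sum>l | (l, i) \<in> elines N. line_power N \<eta> l i) =
      (\<Sum>i\<in>UNIV. \<Sum>l\<in>UNIV. if (l, i) \<in> elines N then line_power N \<eta> l i else 0)"
    by (simp add: sum.If_cases)
  also have "\<dots> = (\<Sum>l\<in>UNIV. \<Sum>i\<in>UNIV. if (l, i) \<in> elines N then line_power N \<eta> l i else 0)"
    by (rule sum.swap)
  also have "\<dots> = (\<Sum>l\<in>UNIV. \<Sum>i | (l, i) \<in> elines N. line_power N \<eta> l i)"
    by (simp add: sum.If_cases)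
  finally show ?thesis
    by (simp add: net_inflow_def sum_subtractf)
qed

text \<open>Induction along an undirected path. An equilibrium equates frequencies only across
  single lines; this spreads the equality over the whole network.\<close>

lemma eq_if_connected:
  assumes "(E \<union> E\<inverse>)\<^sup>* = UNIV" "\<And>i l. (i, l) \<in> E \<Longrightarrow> f i = f l"
  shows "f i = f j"
proof -
  have "(i, j) \<in> (E \<union> E\<inverse>)\<^sup>*"
    using assms(1) by simp
  then show ?thesis
    by induction (auto dest: assms(2))
qed

lemma inner_one_block_vec: "1 \<bullet> block_vec u 0 = 1 \<bullet> u"
  for u :: "real ^ 'm::finite"
  unfolding inner_one_left UNIV_Plus_UNIV[symmetric]
  by (subst sum.Plus) (simp_all add: block_vec_def)

text \<open>Along constant trajectories every differentiated quantity is constant, so each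
  differential equation says that its right-hand side is zero.\<close>

lemma chp_equilibrium_eqs:
  assumes "chp_equilibrium N \<eta> \<omega> pG T hG pU pP hP"
  shows "supported_on pG (generators N)" "supported_on hG (heat_sources N)"
    and "supported_on pU (- {pump_bus N})" "supported_on pP {pump_bus N}"
    and "supported_on hP {pump_edge N}"
    and "\<And>i l. (i, l) \<in> elines N \<Longrightarrow> \<omega> $ i = \<omega> $ l"
    and "\<And>i. i \<noteq> pump_bus N \<Longrightarrow> pU $ i = damping N $ i * \<omega> $ i"
    and "\<And>i. i \<noteq> pump_bus N \<Longrightarrow> - eload N $ i + pG $ i - pU $ i + net_inflow N \<eta> i = 0"
    and "pP $ pump_bus N = net_inflow N \<eta> (pump_bus N)"
    and "\<omega> $ pump_bus N = pump_gain N * avg_temp N T"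
    and "hP $ pump_edge N = cop N * pP $ pump_bus N"
    and "- (A_h N *v T) + block_vec (hG + hP - hload N) 0 = 0"
    and "\<And>i. i \<in> generators N \<Longrightarrow> pG $ i = - (1 / cost_e N $ i * \<omega> $ i)"
    and "\<And>l. l \<in> heat_sources N \<Longrightarrow> hG $ l = - (1 / cost_h N $ l * avg_temp N T)"
proof -
  \<comment> \<open>\<open>order_refl\<close> sets the time to 0; as nothing varies, one instant
    suffices.\<close>
  note eq0 = assms[unfolded chp_equilibrium_def chp_solution_def, rule_format, OF order_refl]
  show "supported_on pG (generators N)" "supported_on hG (heat_sources N)"
    "supported_on pU (- {pump_bus N})" "supported_on pP {pump_bus N}"
    "supported_on hP {pump_edge N}"
    "pP $ pump_bus N = net_inflow N \<eta> (pump_bus N)"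
    "\<omega> $ pump_bus N = pump_gain N * avg_temp N T"
    "hP $ pump_edge N = cop N * pP $ pump_bus N"
    using eq0 by simp_all
  show "- (A_h N *v T) + block_vec (hG + hP - hload N) 0 = 0"
    using eq0 by (blast intro: has_vector_derivative_const_halfline)
  show "\<omega> $ i = \<omega> $ l" if "(i, l) \<in> elines N" for i l
  proof -
    have "((\<lambda>_. \<eta> $ i $ l) has_real_derivative \<omega> $ i - \<omega> $ l) (at 0 within {0..})"
      using eq0 that by blast
    then show ?thesis
      using has_real_derivative_const_halfline by fastforce
  qed
  show "pU $ i = damping N $ i * \<omega> $ i"
    "- eload N $ i + pG $ i - pU $ i + net_inflow N \<eta> i = 0" if "i \<noteq> pump_bus N" for i
    using eq0 that by (blast intro: has_real_derivative_const_halfline)+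
  show "pG $ i = - (1 / cost_e N $ i * \<omega> $ i)" if "i \<in> generators N" for i
  proof -
    have "- (pG $ i) - 1 / cost_e N $ i * \<omega> $ i = 0"
      using eq0 that by (blast intro: has_real_derivative_const_halfline)
    then show ?thesis
      by linarith
  qed
  show "hG $ l = - (1 / cost_h N $ l * avg_temp N T)" if "l \<in> heat_sources N" for l
  proof -
    have "- (hG $ l) - 1 / cost_h N $ l * avg_temp N T = 0"
      using eq0 that by (blast intro: has_real_derivative_const_halfline)
    then show ?thesis
      by linarith
  qed
qed

section \<open>Feasibility of an equilibrium\<close>

lemma chp_equilibrium_feasible:
  fixes N :: "('n::finite, 'e::finite, 'k::finite) chp"
  assumes net: "chp_network N"
    and equ: "chp_equilibrium N \<eta> \<omega> pG T hG pU pP hP"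
  shows "chp_feasible N (pG, hG, pU, pP, hP)"
proof -
  note eqs = chp_equilibrium_eqs[OF equ]
  \<comment> \<open>One balance equation for all buses: at the pump bus load, generation and damping
    power vanish, elsewhere \<open>pP\<close> does.\<close>
  have "- eload N $ i + pG $ i - pU $ i + net_inflow N \<eta> i - pP $ i = 0" for i
  proof (cases "i = pump_bus N")
    case True
    then show ?thesis
      using net eqs(1,3,9) by (simp add: chp_network_def supported_on_def)
  next
    case False
    then show ?thesis
      using eqs(4,8) by (simp add: supported_on_def)
  qed
  then have "(\<Sum>i\<in>UNIV. - eload N $ i + pG $ i - pU $ i + net_inflow N \<eta> i - pP $ i) = 0"
    by simp
  then have power: "1 \<bullet> pG = 1 \<bullet> eload N + 1 \<bullet> pP + 1 \<bullet> pU"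
    by (simp add: inner_one_left sum.distrib sum_subtractf sum_negf sum_net_inflow)
  \<comment> \<open>Zero column sums of \<open>A_h\<close> remove the temperatures from the total
    heat balance.\<close>
  have "1 \<bullet> (A_h N *v T) = (1 v* A_h N) \<bullet> T"
    by (simp add: dot_lmul_matrix)
  also have "\<dots> = 0"
    using net by (simp add: chp_network_def)
  finally have "1 \<bullet> block_vec (hG + hP - hload N) (0 :: real ^ 'k) = 0"
    using arg_cong[OF eqs(12), of "inner 1"] by (simp add: inner_diff_right)
  then have "1 \<bullet> hG = 1 \<bullet> hload N - 1 \<bullet> hP"
    by (simp add: inner_one_block_vec inner_add_right inner_diff_right)
  with power show ?thesis
    using eqs(1-5,11) by (simp add: chp_feasible_def)
qed

section \<open>Optimality and uniqueness\<close>

lemma chp_cost_expand: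
  fixes N :: "('n::finite, 'e::finite, 'k::finite) chp"
  assumes net: "chp_network N"
    and equ: "chp_equilibrium N \<eta> \<omega> pG T hG pU pP hP"
    and feas: "chp_feasible N (pG', hG', pU', pP', hP')"
  shows "chp_cost N (pG', hG', pU', pP', hP') =
    chp_cost N (pG, hG, pU, pP, hP) + chp_cost N (pG' - pG, hG' - hG, pU' - pU, pP' - pP, hP' - hP)"
proof -
  note eqs = chp_equilibrium_eqs[OF equ]
  note feas0 = chp_equilibrium_feasible[OF net equ]
  define w where "w = \<omega> $ pump_bus N"
  define \<theta> where "\<theta> = avg_temp N T"
  have conn: "(elines N \<union> (elines N)\<inverse>)\<^sup>* = UNIV"
    using net by (simp add: chp_network_def)
  have \<omega>: "\<omega> $ i = w" for i
    unfolding w_def using conn eqs(6) by (rule eq_if_connected)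
  have w\<theta>: "w = pump_gain N * \<theta>"
    using eqs(10) by (simp add: w_def \<theta>_def)
  have C: "0 < cop N"
    using net by (simp add: chp_network_def)
  \<comment> \<open>Marginal costs: positive cost and damping coefficients cancel the reciprocals
    and leave one value per block.\<close>
  have gG: "cost_e N $ i * pG $ i = - w" if "i \<in> generators N" for i
    using eqs(13)[OF that] net that by (auto simp: \<omega> chp_network_def)
  have gH: "cost_h N $ l * hG $ l = - \<theta>" if "l \<in> heat_sources N" for l
    using eqs(14)[OF that] net that by (auto simp: \<theta>_def chp_network_def)
  have gU: "(\<chi> i. 1 / damping N $ i) $ i * pU $ i = w" if "i \<in> - {pump_bus N}" for i
    using eqs(7)[of i] net that by (auto simp: \<omega> chp_network_def)
  define dG dH dU dP where "dG = 1 \<bullet> pG' - 1 \<bullet> pG" and "dH = 1 \<bullet> hG' - 1 \<bullet> hG"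
    and "dU = 1 \<bullet> pU' - 1 \<bullet> pU" and "dP = pP' $ pump_bus N - pP $ pump_bus N"
  \<comment> \<open>Subtracting the constraints at the two feasible points cancels the
    loads.\<close>
  have dG: "dG = dP + dU" and dH: "dH = - (cop N * dP)"
    using feas feas0
    by (auto simp: chp_feasible_def dG_def dU_def dH_def dP_def inner_one_supported_singleton
        right_diff_distrib)
  \<comment> \<open>The \<open>dU\<close> terms cancel and
    \<open>- w * dP + pump_gain N * \<theta> * dP\<close> remains. The weight
    \<open>pump_gain N / cop N\<close> is exactly what makes this zero, by the pump law
    \<open>w = pump_gain N * \<theta>\<close>.\<close>
  have gradient: "- w * dG + pump_gain N / cop N * (- \<theta> * dH) + w * dU = 0"
    unfolding dG dH w\<theta> using C by (simp add: field_simps)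
  have supp: "supported_on pG' (generators N)" "supported_on hG' (heat_sources N)"
    "supported_on pU' (- {pump_bus N})"
    using feas by (simp_all add: chp_feasible_def)
  \<comment> \<open>The cost is quadratic, so the remainder is the cost of the displacement. Its
    last two components are mere fillers, as the cost ignores them.\<close>
  have "chp_cost N (pG', hG', pU', pP', hP') = chp_cost N (pG, hG, pU, pP, hP)
      + chp_cost N (pG' - pG, hG' - hG, pU' - pU, pP' - pP, hP' - hP)
      + (- w * dG + pump_gain N / cop N * (- \<theta> * dH) + w * dU)"
    unfolding chp_cost_def Let_def prod.case scaleR_matrix_vector_assoc[symmetric]
      inner_scaleR_right dG_def dH_def dU_def
      diag_form_expand[OF eqs(1) supp(1) gG, simplified]
      diag_form_expand[OF eqs(2) supp(2) gH, simplified]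
      diag_form_expand[OF eqs(3) supp(3) gU, simplified]
    by (simp add: algebra_simps)
  then show ?thesis
    by (simp only: gradient add_0_right)
qed

text \<open>A sum of three nonnegative weighted forms vanishes only if each does. It gives no
  control over the pump components \<open>u\<close> and \<open>v\<close>; their uniqueness has to
  come from the constraints.\<close>

lemma chp_cost_definite:
  fixes N :: "('n::finite, 'e::finite, 'k::finite) chp"
  assumes net: "chp_network N"
    and supp: "supported_on x (generators N)" "supported_on y (heat_sources N)"
      "supported_on z (- {pump_bus N})"
  shows "0 \<le> chp_cost N (x, y, z, u, v)"
    and "chp_cost N (x, y, z, u, v) = 0 \<Longrightarrow> x = 0 \<and> y = 0 \<and> z = 0"
proof -
  have posG: "0 < cost_e N $ i" if "i \<in> generators N" for i
    using net that by (simp add: chp_network_def)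
  have posH: "0 < cost_h N $ l" if "l \<in> heat_sources N" for l
    using net that by (simp add: chp_network_def)
  have posU: "0 < (\<chi> i. 1 / damping N $ i) $ i" if "i \<in> - {pump_bus N}" for i
    using net that by (simp add: chp_network_def)
  have \<alpha>: "0 < pump_gain N / cop N"
    using net by (simp add: chp_network_def)
  define G H U where "G = x \<bullet> (diag (cost_e N) *v x)"
    and "H = pump_gain N / cop N * (y \<bullet> (diag (cost_h N) *v y))"
    and "U = z \<bullet> (diag (\<chi> i. 1 / damping N $ i) *v z)"
  have nonneg: "0 \<le> G" "0 \<le> H" "0 \<le> U"
    unfolding G_def H_def U_def
    using diag_form_nonneg[OF supp(1) posG] diag_form_nonneg[OF supp(3) posU]
      mult_nonneg_nonneg[OF less_imp_le[OF \<alpha>] diag_form_nonneg[OF supp(2) posH]] by blast+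
  have cost: "chp_cost N (x, y, z, u, v) = 1/2 * G + 1/2 * H + 1/2 * U"
    unfolding chp_cost_def Let_def G_def H_def U_def
    by (simp add: scaleR_matrix_vector_assoc[symmetric])
  show "0 \<le> chp_cost N (x, y, z, u, v)"
    unfolding cost using nonneg by linarith
  assume "chp_cost N (x, y, z, u, v) = 0"
  then have "G = 0" "H = 0" "U = 0"
    unfolding cost using nonneg by linarith+
  then have "x \<bullet> (diag (cost_e N) *v x) = 0" "y \<bullet> (diag (cost_h N) *v y) = 0"
    "z \<bullet> (diag (\<chi> i. 1 / damping N $ i) *v z) = 0"
    using \<alpha> unfolding G_def H_def U_def by auto
  then show "x = 0 \<and> y = 0 \<and> z = 0"
    using diag_form_eq_0D[OF supp(1) posG] diag_form_eq_0D[OF supp(2) posH]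
      diag_form_eq_0D[OF supp(3) posU] by blast
qed

theorem theorem7:
  fixes N :: "('n::finite, 'e::finite, 'k::finite) chp"
  assumes "chp_network N"
    and "chp_equilibrium N \<eta> \<omega> pG T hG pU pP hP"
  shows "is_arg_min (chp_cost N) (chp_feasible N) (pG, hG, pU, pP, hP) \<and>
    (\<forall>z. is_arg_min (chp_cost N) (chp_feasible N) z \<longrightarrow> z = (pG, hG, pU, pP, hP))"
proof -
  let ?x = "(pG, hG, pU, pP, hP)"
  note feas = chp_equilibrium_feasible[OF assms]
  have le: "chp_cost N ?x \<le> chp_cost N z"
    and eq: "chp_cost N z \<le> chp_cost N ?x \<Longrightarrow> z = ?x" if "chp_feasible N z" for z
  proof -
    obtain pG' hG' pU' pP' hP' where z: "z = (pG', hG', pU', pP', hP')"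
      by (cases z)
    note feas' = that[unfolded z]
    have supp: "supported_on (pG' - pG) (generators N)" "supported_on (hG' - hG) (heat_sources N)"
      "supported_on (pU' - pU) (- {pump_bus N})"
      using feas feas' by (auto simp: chp_feasible_def intro: supported_on_diff)
    note expand = chp_cost_expand[OF assms feas']
    note definite = chp_cost_definite[OF assms(1) supp, of "pP' - pP" "hP' - hP"]
    show "chp_cost N ?x \<le> chp_cost N z"
      unfolding z expand using definite(1) by simp
    assume "chp_cost N z \<le> chp_cost N ?x"
    then have "chp_cost N (pG' - pG, hG' - hG, pU' - pU, pP' - pP, hP' - hP) = 0"
      unfolding z expand using definite(1) by linarith
    then have *: "pG' = pG" "hG' = hG" "pU' = pU"
      using definite(2) by auto
    \<comment> \<open>Power balance fixes the total of \<open>pP'\<close>, hence its only entry; the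
      conversion law then fixes \<open>hP'\<close>.\<close>
    have "pP' = pP"
      using feas feas' * by (auto simp: chp_feasible_def inner_one_supported_singleton
          intro!: supported_on_singleton_eqI)
    moreover from this have "hP' = hP"
      using feas feas' by (auto simp: chp_feasible_def intro!: supported_on_singleton_eqI)
    ultimately show "z = ?x"
      using * z by simp
  qed
  show ?thesis
    \<comment> \<open>\<open>is_arg_min\<close> excludes strictly smaller feasible values, so any
      minimizer \<open>z\<close> satisfies the premise of \<open>eq\<close>.\<close>
    unfolding is_arg_min_def using feas le eq by (meson not_less)
qed

end
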